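(* For any integers $d \ge 3$, $v_\circ \ge 1$ and $v_\bullet \ge d$, there is a stacked $d$-polytope $S$ and a partition $V_\circ \sqcup V_\bullet$ of the vertices of $S$ with $|V_\circ| = v_\circ$ and $|V_\bullet| = v_\bullet$ such that the number $e_{\circ\bullet}$ of edges of $S$ having one endpoint in $V_\circ$ and the other in $V_\bullet$ satisfies $$e_{\circ\bullet} = \frac{m(2d+1-m)}{2}, \qquad \text{where } m = \min(d, v_\circ).$$
   Context: A polytope is the convex hull of finitely many points; a $d$-polytope is a polytope of dimension $d$; its facets are its faces of dimension $d-1$, its vertices are its $0$-dimensional faces and its edges are its $1$-dimensional faces. A stacked $d$-polytope is defined recursively: it is either a $d$-simplex, or a $d$-polytope with $n \ge d+2$ vertices obtained as the convex hull of a stacked $d$-polytope with $n-1$ vertices together with a point located very close to one of its facets, so that the point is visible from this facet but not from the other facets (i.e. it lies strictly beyond that facet and strictly beneath every other facet). *)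

theory Defs
  imports "HOL-Analysis.Analysis"
begin

text \<open>
  The next two notions are meant for a facet \<open>F\<close> of a polytope \<open>P\<close> and a point \<open>p\<close> of the
  affine hull of \<open>P\<close>. There the closed half-space \<open>{x. a \<bullet> x \<le> b}\<close> that contains \<open>P\<close> and
  touches it exactly in \<open>F\<close> has a unique trace on the affine hull of \<open>P\<close>, so the choice of
  \<open>a\<close> and \<open>b\<close> does not matter.
\<close>

definition strictly_beyond :: "'a::euclidean_space set \<Rightarrow> 'a set \<Rightarrow> 'a \<Rightarrow> bool"
  where "strictly_beyond P F p \<longleftrightarrow>
    (\<exists>a b. P \<subseteq> {x. a \<bullet> x \<le> b} \<and> F = P \<inter> {x. a \<bullet> x = b} \<and> a \<bullet> p > b)"

definition strictly_beneath :: "'a::euclidean_space set \<Rightarrow> 'a set \<Rightarrow> 'a \<Rightarrow> bool"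
  where "strictly_beneath P F p \<longleftrightarrow>
    (\<exists>a b. P \<subseteq> {x. a \<bullet> x \<le> b} \<and> F = P \<inter> {x. a \<bullet> x = b} \<and> a \<bullet> p < b)"

text \<open>
  The condition \<open>p \<in> affine hull P\<close> keeps the dimension equal to \<open>d\<close>; it is vacuous when the
  ambient space has dimension \<open>d\<close>. Each stacking step adds exactly the vertex \<open>p\<close> and keeps
  all vertices of \<open>P\<close> when \<open>d \<ge> 2\<close>, so the number of vertices need not be recorded.
\<close>

inductive stacked_polytope :: "nat \<Rightarrow> 'a::euclidean_space set \<Rightarrow> bool" for d :: nat
  where
    simplex: "int d simplex S \<Longrightarrow> stacked_polytope d S"
  | stack: "\<lbrakk>stacked_polytope d P; F facet_of P; p \<in> affine hull P; strictly_beyond P F p;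
        \<And>G. G facet_of P \<Longrightarrow> G \<noteq> F \<Longrightarrow> strictly_beneath P G p\<rbrakk>
      \<Longrightarrow> stacked_polytope d (convex hull (insert p P))"

definition polytope_vertices :: "'a::euclidean_space set \<Rightarrow> 'a set"
  where "polytope_vertices P = {v. {v} face_of P}"

definition edges_between :: "'a::euclidean_space set \<Rightarrow> 'a set \<Rightarrow> 'a set \<Rightarrow> 'a set set"
  where "edges_between P U W =
    {E. E edge_of P \<and> (\<exists>u\<in>U. \<exists>w\<in>W. E = closed_segment u w)}"

end

theory Submission
  imports Defs
begin

text \<open>
  The polytope is obtained by stacking along a path. Write \<open>d\<close> for the dimension, and take points
  \<open>p 0, p 1, p 2, \<dots>\<close> such that the first \<open>d + 1\<close> span a simplex and each later point is stacked
  onto the facet spanned by the \<open>d\<close> points just before it. That facet is available: a stacking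
  onto a facet \<open>F\<close> creates for every facet \<open>T\<close> of \<open>F\<close> a new facet, the pyramid over \<open>T\<close>, and
  here \<open>F\<close> is a simplex and \<open>T\<close> omits the oldest vertex of \<open>F\<close>. A stacking adds exactly the edges from the new
  vertex to the \<open>d\<close> vertices of \<open>F\<close>, so \<open>p i\<close> and \<open>p j\<close> are adjacent if and only if
  \<open>\<bar>i - j\<bar> \<le> d\<close>.

  Now colour the first \<open>v\<^sub>2\<close> points black and the remaining \<open>v\<^sub>1\<close> points white. As
  \<open>v\<^sub>2 \<ge> d\<close>, the \<open>d\<close> predecessors of the white point number \<open>t\<close> (counting from \<open>0\<close>) are \<open>t\<close> white
  and \<open>d - t\<close> black points when \<open>t \<le> d\<close>, and are all white afterwards. The number of bichromatic
  edges is therefore \<open>d + (d - 1) + \<dots>\<close> with \<open>m = min d v\<^sub>1\<close> summands, which is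
  \<open>m (2 d + 1 - m) / 2\<close>.

  The geometric content lies in the effect of one stacking on the face lattice. Proper faces
  other than \<open>F\<close> survive (\<open>face_of_stacking_old\<close>), nonempty proper faces of \<open>F\<close> get a pyramid over them
  (\<open>face_of_stacking_pyramid\<close>), faces that avoid the new point are old
  (\<open>face_of_stacking_imp_face_of\<close>), and the new point is not adjacent to vertices outside \<open>F\<close>
  (\<open>face_of_stacking_hidden\<close>). Everything takes place in full dimension, and \<open>d \<ge> 3\<close> guarantees
  that no edge is itself a facet, hence that no edge is lost in a stacking.
\<close>

section \<open>Stacking a point onto a facet\<close>

text \<open>
  The geometric side conditions of the stacking step in \<open>stacked_polytope\<close>, collected for a
  facet \<open>F\<close> and the new point \<open>p\<close>.
\<close>

definition stackable :: "'a::euclidean_space set \<Rightarrow> 'a set \<Rightarrow> 'a \<Rightarrow> bool"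
  where "stackable P F p \<longleftrightarrow> F facet_of P \<and> strictly_beyond P F p \<and>
    (\<forall>G. G facet_of P \<longrightarrow> G \<noteq> F \<longrightarrow> strictly_beneath P G p)"

lemma facet_subset_facet_imp_eq:
  assumes "convex P" "F facet_of P" "G facet_of P" "F \<subseteq> G"
  shows "F = G"
proof (rule ccontr)
  assume "F \<noteq> G"
  have "F face_of G"
    using assms face_of_subset facet_of_imp_face_of facet_of_imp_subset by blast
  moreover have "convex G"
    using assms facet_of_imp_face_of face_of_imp_convex by blast
  ultimately have "aff_dim F < aff_dim G"
    using \<open>F \<noteq> G\<close> face_of_aff_dim_lt by blast
  then show False
    using assms by (simp add: facet_of_def)
qed

text \<open>
  A point in the relative interior of \<open>F\<close> lies in no other facet, so it satisfies the inequalities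
  of the other facets strictly. As there are only finitely many of them, they survive a small
  displacement along the outer normal of \<open>F\<close>.
\<close>

lemma exists_stackable_point:
  fixes P :: "'a::euclidean_space set"
  assumes "polytope P" "F facet_of P"
  shows "\<exists>p. stackable P F p"
proof -
  have poly: "polyhedron P" and cvx: "convex P"
    using assms(1) polytope_imp_polyhedron polytope_imp_convex by auto
  have exposed: "\<exists>a b. P \<subseteq> {x. a \<bullet> x \<le> b} \<and> G = P \<inter> {x. a \<bullet> x = b}" if "G facet_of P" for G
    using that exposed_face_of_polyhedron[OF poly] facet_of_imp_face_of
    unfolding exposed_face_of_def by blast
  obtain a b where ab: "P \<subseteq> {x. a \<bullet> x \<le> b}" "F = P \<inter> {x. a \<bullet> x = b}"
    using exposed[OF assms(2)] by blast
  have "a \<noteq> 0"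
  proof
    assume "a = 0"
    moreover have "F \<noteq> {}" "F \<noteq> P"
      using assms(2) by (auto simp: facet_of_def)
    ultimately show False
      using ab(2) by (auto split: if_splits)
  qed
  have "convex F" "F \<noteq> {}"
    using assms(2) face_of_imp_convex[of F P] by (auto simp: facet_of_def)
  then obtain z where z: "z \<in> rel_interior F"
    using rel_interior_eq_empty by blast
  then have zF: "z \<in> F"
    using rel_interior_subset by blast
  obtain A B where AB: "\<And>G. G facet_of P \<Longrightarrow> P \<subseteq> {x. A G \<bullet> x \<le> B G} \<and> G = P \<inter> {x. A G \<bullet> x = B G}"
    using exposed by metis
  have z_strict: "A G \<bullet> z < B G" if G: "G facet_of P" "G \<noteq> F" for G
  proof -
    have "z \<notin> G"
    proof
      assume "z \<in> G"
      then have "F \<subseteq> G"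
        using subset_of_face_of[OF facet_of_imp_face_of[OF G(1)] facet_of_imp_subset[OF assms(2)]] z
        by blast
      then show False
        using facet_subset_facet_imp_eq[OF cvx assms(2) G(1)] G(2) by simp
    qed
    moreover have "z \<in> P"
      using zF facet_of_imp_subset[OF assms(2)] by blast
    ultimately show ?thesis
      using AB[OF G(1)] by force
  qed
  have "finite {G. G facet_of P \<and> G \<noteq> F}"
    by (rule finite_subset[OF _ finite_polytope_facets[OF assms(1)]]) auto
  moreover have "\<forall>\<^sub>F e in at_right 0. A G \<bullet> (z + e *\<^sub>R a) < B G"
    if "G \<in> {G. G facet_of P \<and> G \<noteq> F}" for G
  proof -
    have "((\<lambda>e. A G \<bullet> (z + e *\<^sub>R a)) \<longlongrightarrow> A G \<bullet> (z + 0 *\<^sub>R a)) (at_right 0)"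
      by (intro tendsto_intros)
    then show ?thesis
      using z_strict that by (intro order_tendstoD(2)) auto
  qed
  ultimately have "\<forall>\<^sub>F e in at_right 0. \<forall>G\<in>{G. G facet_of P \<and> G \<noteq> F}. A G \<bullet> (z + e *\<^sub>R a) < B G"
    by (intro eventually_ball_finite ballI)
  moreover have "\<forall>\<^sub>F e in at_right 0. (0::real) < e"
    by (rule eventually_at_right_less)
  ultimately have "\<forall>\<^sub>F e in at_right 0.
      (\<forall>G\<in>{G. G facet_of P \<and> G \<noteq> F}. A G \<bullet> (z + e *\<^sub>R a) < B G) \<and> (0::real) < e"
    by (rule eventually_conj)
  then have "\<exists>e. (\<forall>G\<in>{G. G facet_of P \<and> G \<noteq> F}. A G \<bullet> (z + e *\<^sub>R a) < B G) \<and> (0::real) < e"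
    by (intro eventually_happens'[of "at_right (0::real)"]) simp_all
  then obtain e :: real where e: "0 < e" "\<And>G. G facet_of P \<Longrightarrow> G \<noteq> F \<Longrightarrow> A G \<bullet> (z + e *\<^sub>R a) < B G"
    by blast
  have "a \<bullet> (z + e *\<^sub>R a) > b"
    using zF ab(2) e(1) \<open>a \<noteq> 0\<close> by (auto simp: inner_add_right)
  then have "strictly_beyond P F (z + e *\<^sub>R a)"
    unfolding strictly_beyond_def using ab by blast
  moreover have "strictly_beneath P G (z + e *\<^sub>R a)" if "G facet_of P" "G \<noteq> F" for G
    unfolding strictly_beneath_def using AB[OF that(1)] e(2)[OF that] by blast
  ultimately show ?thesis
    unfolding stackable_def using assms(2) by blast
qed

section \<open>Faces of a stacked polytope\<close>

text \<open>
  A convex combination of points of a closed half-space lies on the bounding hyperplane only if all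
  points of positive weight do. This is the tool for exhibiting faces of a stacked polytope.
\<close>

lemma convex_hull_insert_Int_supporting_hyperplane:
  fixes P :: "'a::euclidean_space set"
  assumes "convex P" "P \<subseteq> {x. a \<bullet> x \<le> b}" "a \<bullet> p \<le> b"
  shows "(convex hull insert p P) \<inter> {x. a \<bullet> x = b} = convex hull (insert p P \<inter> {x. a \<bullet> x = b})"
    (is "?L = ?R")
proof
  show "?R \<subseteq> ?L"
  proof -
    have "?R \<subseteq> convex hull insert p P"
      by (intro hull_mono) auto
    moreover have "?R \<subseteq> {x. a \<bullet> x = b}"
      by (intro hull_minimal convex_hyperplane) auto
    ultimately show ?thesis
      by blast
  qed
  show "?L \<subseteq> ?R"
  proof
    fix x assume x: "x \<in> ?L"
    show "x \<in> ?R"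
    proof (cases "P = {}")
      case True
      with x show ?thesis by auto
    next
      case False
      then obtain u v y where uv: "0 \<le> u" "0 \<le> v" "u + v = 1" "y \<in> P" "x = u *\<^sub>R p + v *\<^sub>R y"
        using x convex_hull_insert[OF False, of p] assms(1) by (auto simp: hull_same)
      have "u * (b - a \<bullet> p) + v * (b - a \<bullet> y) = (u + v) * b - a \<bullet> x"
        unfolding uv(5) by (simp add: inner_add_right algebra_simps)
      then have s: "u * (b - a \<bullet> p) + v * (b - a \<bullet> y) = 0"
        using x uv(3) by simp
      have "0 \<le> u * (b - a \<bullet> p)" "0 \<le> v * (b - a \<bullet> y)"
        using uv assms by auto
      with s have "u * (b - a \<bullet> p) = 0" "v * (b - a \<bullet> y) = 0"
        by linarith+
      then have "u = 0 \<or> a \<bullet> p = b" "v = 0 \<or> a \<bullet> y = b"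
        by auto
      then show ?thesis
      proof (elim disjE)
        assume "u = 0" "v = 0" then show ?thesis using uv by simp
      next
        assume "u = 0" "a \<bullet> y = b"
        then show ?thesis using uv by (auto intro!: hull_inc)
      next
        assume "a \<bullet> p = b" "v = 0"
        then show ?thesis using uv by (auto intro!: hull_inc)
      next
        assume "a \<bullet> p = b" "a \<bullet> y = b"
        then have "p \<in> ?R" "y \<in> ?R"
          using uv by (auto intro!: hull_inc)
        then show ?thesis
          unfolding uv(5) using uv(1-3) convexD[OF convex_convex_hull] by blast
      qed
    qed
  qed
qed

lemma supporting_hyperplane_face_of_convex_hull_insert:
  fixes P :: "'a::euclidean_space set"
  assumes "convex P" "P \<subseteq> {x. a \<bullet> x \<le> b}" "a \<bullet> p \<le> b"
  shows "convex hull (insert p P \<inter> {x. a \<bullet> x = b}) face_of convex hull insert p P"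
proof -
  have "convex hull insert p P \<subseteq> {x. a \<bullet> x \<le> b}"
    using assms by (intro hull_minimal convex_halfspace_le) auto
  then have "(convex hull insert p P) \<inter> {x. a \<bullet> x = b} face_of convex hull insert p P"
    by (intro face_of_Int_supporting_hyperplane_le) auto
  then show ?thesis
    using convex_hull_insert_Int_supporting_hyperplane[OF assms] by simp
qed

lemma stackable_notin:
  assumes "stackable P F p"
  shows "p \<notin> P"
  using assms unfolding stackable_def strictly_beyond_def by force

lemma stackable_notin_affine_hull:
  assumes "stackable P F p"
  shows "p \<notin> affine hull F"
proof -
  obtain a b where ab: "F = P \<inter> {x. a \<bullet> x = b}" "a \<bullet> p > b"
    using assms unfolding stackable_def strictly_beyond_def by blast
  have "affine hull F \<subseteq> {x. a \<bullet> x = b}"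
    using ab(1) by (intro hull_minimal affine_hyperplane) auto
  then show ?thesis
    using ab(2) by auto
qed

text \<open>
  A nonempty \<open>G\<close> is the intersection of the facets containing it, so \<open>F\<close> cannot be the only one of
  them. Any other facet remains a face because the new point lies strictly beneath it.
\<close>

lemma face_of_stacking_old:
  fixes P :: "'a::euclidean_space set"
  assumes P: "polytope P" and st: "stackable P F p"
    and G: "G face_of P" "G \<noteq> P" "G \<noteq> F"
  shows "G face_of convex hull insert p P"
proof (cases "G = {}")
  case False
  have poly: "polyhedron P" and cvx: "convex P"
    using P polytope_imp_polyhedron polytope_imp_convex by auto
  have Geq: "G = \<Inter>{H. H facet_of P \<and> G \<subseteq> H}"
    using face_of_polyhedron[OF poly G(1) False G(2)] .
  obtain H where H: "H facet_of P" "G \<subseteq> H" "H \<noteq> F"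
  proof (rule ccontr)
    assume "\<not> thesis"
    then have "{H. H facet_of P \<and> G \<subseteq> H} \<subseteq> {F}"
      using that by blast
    moreover have "{H. H facet_of P \<and> G \<subseteq> H} \<noteq> {}"
      using face_of_polyhedron_subset_facet[OF poly G(1) False G(2)] by blast
    ultimately have "{H. H facet_of P \<and> G \<subseteq> H} = {F}"
      by blast
    then show False
      using Geq G(3) by simp
  qed
  then obtain a b where ab: "P \<subseteq> {x. a \<bullet> x \<le> b}" "H = P \<inter> {x. a \<bullet> x = b}" "a \<bullet> p < b"
    using st unfolding stackable_def strictly_beneath_def by blast
  have "convex hull (insert p P \<inter> {x. a \<bullet> x = b}) = H"
    using ab face_of_imp_convex[OF facet_of_imp_face_of[OF H(1)]] by (simp add: hull_same)
  then have "H face_of convex hull insert p P"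
    using supporting_hyperplane_face_of_convex_hull_insert[OF cvx ab(1), of p] ab(3) by simp
  moreover have "G face_of H"
    using face_of_subset[OF G(1) H(2) facet_of_imp_subset[OF H(1)]] .
  ultimately show ?thesis
    using face_of_trans by blast
qed auto

text \<open>
  The face \<open>T\<close> is cut out of \<open>F\<close> by the other facets that contain it. The sum of the inequalities
  of these facets is strictly satisfied at \<open>p\<close>, while the inequality of \<open>F\<close> is violated there. So
  some positive combination of the two is tight at \<open>p\<close>; on \<open>P\<close> it is tight exactly on \<open>T\<close>.
\<close>

lemma face_of_stacking_pyramid:
  fixes P :: "'a::euclidean_space set"
  assumes P: "polytope P" and st: "stackable P F p"
    and T: "T face_of P" "T \<subseteq> F" "T \<noteq> F" "T \<noteq> {}"
  shows "convex hull insert p T face_of convex hull insert p P"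
proof -
  have poly: "polyhedron P" and cvx: "convex P"
    using P polytope_imp_polyhedron polytope_imp_convex by auto
  have F: "F facet_of P"
    using st by (simp add: stackable_def)
  then have "T \<noteq> P"
    using T facet_of_imp_subset by blast
  define \<G> where "\<G> = {H. H facet_of P \<and> T \<subseteq> H} - {F}"
  have Teq: "T = F \<inter> \<Inter>\<G>"
    using face_of_polyhedron[OF poly T(1) T(4) \<open>T \<noteq> P\<close>] F T(2) unfolding \<G>_def by blast
  then have ne: "\<G> \<noteq> {}"
    using T(3) by auto
  have fin: "finite \<G>"
    unfolding \<G>_def by (rule finite_subset[OF _ finite_polytope_facets[OF P]]) auto
  have "\<exists>a b. P \<subseteq> {x. a \<bullet> x \<le> b} \<and> H = P \<inter> {x. a \<bullet> x = b} \<and> a \<bullet> p < b" if "H \<in> \<G>" for H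
    using st that unfolding stackable_def strictly_beneath_def \<G>_def by blast
  then obtain A B where AB:
    "\<And>H. H \<in> \<G> \<Longrightarrow> P \<subseteq> {x. A H \<bullet> x \<le> B H} \<and> H = P \<inter> {x. A H \<bullet> x = B H} \<and> A H \<bullet> p < B H"
    by metis
  then have AB_iff: "x \<in> H \<longleftrightarrow> A H \<bullet> x = B H" if "H \<in> \<G>" "x \<in> P" for H x
    using that by blast
  obtain a b where ab: "P \<subseteq> {x. a \<bullet> x \<le> b}" "F = P \<inter> {x. a \<bullet> x = b}" "a \<bullet> p > b"
    using st unfolding stackable_def strictly_beyond_def by blast
  \<comment> \<open>The total slack of the inequalities of the other facets: zero on \<open>P\<close> only in their intersection.\<close>
  define s where "s x = (\<Sum>H\<in>\<G>. B H - A H \<bullet> x)" for x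
  have s_nonneg: "0 \<le> s x" if "x \<in> P" for x
    unfolding s_def using AB that by (intro sum_nonneg) force
  have s_zero: "s x = 0 \<longleftrightarrow> x \<in> \<Inter>\<G>" if "x \<in> P" for x
  proof -
    have "s x = 0 \<longleftrightarrow> (\<forall>H\<in>\<G>. B H - A H \<bullet> x = 0)"
      unfolding s_def using AB that fin by (intro sum_nonneg_eq_0_iff) force+
    also have "\<dots> \<longleftrightarrow> (\<forall>H\<in>\<G>. x \<in> H)"
      using AB_iff that by (intro ball_cong refl) auto
    also have "\<dots> \<longleftrightarrow> x \<in> \<Inter>\<G>"
      by simp
    finally show ?thesis .
  qed
  have s_p: "0 < s p"
    unfolding s_def using AB fin ne by (intro sum_pos) auto
  \<comment> \<open>The weight for the inequality of \<open>F\<close> that makes the combination tight at \<open>p\<close>.\<close>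
  define l where "l = s p / (a \<bullet> p - b)"
  have l: "0 < l"
    using s_p ab(3) by (simp add: l_def)
  define c where "c = (\<Sum>H\<in>\<G>. A H) + l *\<^sub>R a"
  define e where "e = (\<Sum>H\<in>\<G>. B H) + l * b"
  have ce: "e - c \<bullet> x = s x + l * (b - a \<bullet> x)" for x
    by (simp add: c_def e_def s_def inner_add_left inner_sum_left sum_subtractf algebra_simps)
  have "e - c \<bullet> p = 0"
    unfolding ce l_def using ab(3) by (simp add: field_simps)
  then have cp: "c \<bullet> p = e"
    by simp
  have cP: "P \<subseteq> {x. c \<bullet> x \<le> e}"
  proof
    fix x assume x: "x \<in> P"
    then have "0 \<le> l * (b - a \<bullet> x)"
      using l ab(1) by auto
    then show "x \<in> {x. c \<bullet> x \<le> e}"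
      using ce[of x] s_nonneg[OF x] by simp
  qed
  have "x \<in> T \<longleftrightarrow> c \<bullet> x = e" if x: "x \<in> P" for x
  proof -
    have nn: "0 \<le> l * (b - a \<bullet> x)"
      using l ab(1) x by auto
    have "c \<bullet> x = e \<longleftrightarrow> s x + l * (b - a \<bullet> x) = 0"
      using ce[of x] by auto
    also have "\<dots> \<longleftrightarrow> s x = 0 \<and> l * (b - a \<bullet> x) = 0"
      using nn s_nonneg[OF x] by (simp add: add_nonneg_eq_0_iff)
    also have "\<dots> \<longleftrightarrow> x \<in> \<Inter>\<G> \<and> x \<in> F"
      using s_zero[OF x] l ab(2) x by auto
    finally show ?thesis
      using Teq by blast
  qed
  then have "insert p P \<inter> {x. c \<bullet> x = e} = insert p T"
    using cp face_of_imp_subset[OF T(1)] by auto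
  then show ?thesis
    using supporting_hyperplane_face_of_convex_hull_insert[OF cvx cP, of p] cp by simp
qed

text \<open>
  A face of a convex hull is spanned by the generators it contains; without \<open>p\<close> it stays inside \<open>P\<close>.
\<close>

lemma face_of_stacking_imp_face_of:
  fixes P :: "'a::euclidean_space set"
  assumes "polytope P" "E face_of convex hull insert p P" "p \<notin> E"
  shows "E face_of P"
proof -
  obtain V where V: "finite V" "P = convex hull V"
    using assms(1) polytope_def by blast
  have "E face_of convex hull insert p V"
    using assms(2) V(2) hull_insert[of convex p V] by simp
  then obtain S where S: "S \<subseteq> insert p V" "E = convex hull S"
    using face_of_convex_hull_subset[of "insert p V" E] V(1) finite_imp_compact by blast
  then have "S \<subseteq> P"
    using assms(3) V(2) hull_inc[of _ S convex] hull_subset[of V convex] by blast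
  then have "E \<subseteq> P"
    using S(2) assms(1) by (simp add: hull_minimal polytope_imp_convex)
  then show ?thesis
    using face_of_subset[OF assms(2)] hull_subset[of "insert p P" convex] by blast
qed

text \<open>
  Otherwise a segment from an interior point to \<open>x\<close> would meet the boundary, hence some facet, although
  the inequality of that facet is valid at one end and strict at \<open>x\<close>.
\<close>

lemma beneath_all_facets_imp_interior:
  fixes P :: "'a::euclidean_space set"
  assumes P: "polytope P" and dim: "aff_dim P = DIM('a)"
    and beneath: "\<And>G. G facet_of P \<Longrightarrow> strictly_beneath P G x"
  shows "x \<in> interior P"
proof (rule ccontr)
  assume x: "x \<notin> interior P"
  have ri: "rel_interior P = interior P"
    using interior_rel_interior dim by blast
  have "P \<noteq> {}"
    using dim by auto
  then obtain z where z: "z \<in> interior P"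
    using rel_interior_eq_empty[of P] P polytope_imp_convex ri by blast
  have "closed_segment z x \<inter> frontier (interior P) \<noteq> {}"
    using x z by (intro connected_Int_frontier) auto
  then obtain y where y: "y \<in> closed_segment z x" "y \<in> frontier P"
    using frontier_interior_subset by blast
  have "frontier P = rel_frontier P"
    using rel_frontier_frontier dim aff_dim_eq_full by blast
  then obtain G where G: "G facet_of P" "y \<in> G"
    using y(2) rel_frontier_of_polyhedron[OF polytope_imp_polyhedron[OF P]] by auto
  obtain a b where ab: "P \<subseteq> {x. a \<bullet> x \<le> b}" "G = P \<inter> {x. a \<bullet> x = b}" "a \<bullet> x < b"
    using beneath[OF G(1)] unfolding strictly_beneath_def by blast
  have zb: "a \<bullet> z \<le> b"
    using z ab(1) interior_subset by blast
  have "y \<noteq> z"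
    using z y(2) by (auto simp: frontier_def)
  obtain t where t: "0 \<le> t" "t \<le> 1" "y = (1 - t) *\<^sub>R z + t *\<^sub>R x"
    using y(1) by (auto simp: in_segment)
  with \<open>y \<noteq> z\<close> have "0 < t"
    by (cases "t = 0") auto
  have "a \<bullet> y = (1 - t) * (a \<bullet> z) + t * (a \<bullet> x)"
    by (simp add: t(3) inner_add_right)
  also have "\<dots> < (1 - t) * b + t * b"
    using t zb ab(3) \<open>0 < t\<close> by (intro add_le_less_mono mult_left_mono mult_strict_left_mono) auto
  finally show False
    using G(2) ab(2) by (simp add: algebra_simps)
qed

text \<open>
  The segment from \<open>v\<close> to \<open>p\<close> runs, right after \<open>v\<close>, strictly beneath every facet of \<open>P\<close>: beneath
  \<open>F\<close> because \<open>v\<close> is, and beneath the others because \<open>p\<close> is. So it passes through the interior,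
  which no proper face meets.
\<close>

lemma face_of_stacking_hidden:
  fixes P :: "'a::euclidean_space set"
  assumes P: "polytope P" and dim: "aff_dim P = DIM('a)" and st: "stackable P F p"
    and v: "v \<in> P" "v \<notin> F"
    and E: "E face_of convex hull insert p P" "p \<in> E" "v \<in> E"
  shows "E = convex hull insert p P"
proof (rule ccontr)
  assume neq: "E \<noteq> convex hull insert p P"
  obtain a b where ab: "P \<subseteq> {x. a \<bullet> x \<le> b}" "F = P \<inter> {x. a \<bullet> x = b}" "a \<bullet> p > b"
    using st unfolding stackable_def strictly_beyond_def by blast
  have vb: "a \<bullet> v < b"
    using v ab by force
  \<comment> \<open>Half of the parameter at which the segment reaches the hyperplane of \<open>F\<close>.\<close>
  define t where "t = (b - a \<bullet> v) / 2 / (a \<bullet> p - a \<bullet> v)"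
  have t: "0 < t" "t < 1"
    using vb ab(3) by (auto simp: t_def field_simps)
  define x where "x = (1 - t) *\<^sub>R v + t *\<^sub>R p"
  have ax: "a \<bullet> x < b"
  proof -
    have "a \<bullet> x = a \<bullet> v + t * (a \<bullet> p - a \<bullet> v)"
      by (simp add: x_def inner_add_right algebra_simps)
    also have "\<dots> = a \<bullet> v + (b - a \<bullet> v) / 2"
      using vb ab(3) by (simp add: t_def del: divide_divide_eq_left)
    also have "\<dots> < b"
      using vb by (simp add: field_simps)
    finally show ?thesis .
  qed
  have "strictly_beneath P G x" if G: "G facet_of P" for G
  proof (cases "G = F")
    case True
    then show ?thesis
      unfolding strictly_beneath_def using ab ax by blast
  next
    case False
    then obtain a' b' where ab': "P \<subseteq> {x. a' \<bullet> x \<le> b'}" "G = P \<inter> {x. a' \<bullet> x = b'}" "a' \<bullet> p < b'"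
      using st G unfolding stackable_def strictly_beneath_def by blast
    have "a' \<bullet> x = (1 - t) * (a' \<bullet> v) + t * (a' \<bullet> p)"
      by (simp add: x_def inner_add_right)
    also have "\<dots> < (1 - t) * b' + t * b'"
      using t v(1) ab'
      by (intro add_le_less_mono mult_left_mono mult_strict_left_mono) auto
    finally have "a' \<bullet> x < b'"
      by (simp add: algebra_simps)
    then show ?thesis
      unfolding strictly_beneath_def using ab' by blast
  qed
  then have "x \<in> interior P"
    by (intro beneath_all_facets_imp_interior[OF P dim])
  then have "x \<in> interior (convex hull insert p P)"
    using interior_mono[of P "convex hull insert p P"] hull_subset[of "insert p P" convex] by blast
  moreover have "x \<in> E"
    using convexD_alt[OF face_of_imp_convex[OF E(1)] E(3) E(2)] t by (simp add: x_def)
  ultimately show False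
    using face_of_disjoint_interior[OF E(1) neq] by blast
qed

lemma aff_dim_stacking:
  fixes P :: "'a::euclidean_space set"
  assumes "aff_dim P = DIM('a)"
  shows "aff_dim (convex hull insert p P) = DIM('a)"
proof -
  have "aff_dim P \<le> aff_dim (convex hull insert p P)"
    by (intro aff_dim_subset) (meson hull_subset insert_subset)
  then show ?thesis
    using assms aff_dim_le_DIM[of "convex hull insert p P"] by simp
qed

text \<open>
  In dimension at least \<open>2\<close> a vertex is not a facet, so no vertex is lost.
\<close>

lemma polytope_vertices_stacking:
  fixes P :: "'a::euclidean_space set"
  assumes P: "polytope P" and dim: "aff_dim P = DIM('a)" "DIM('a) \<ge> 2"
    and st: "stackable P F p"
  shows "polytope_vertices (convex hull insert p P) = insert p (polytope_vertices P)"
proof -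
  have Fdim: "aff_dim F = int DIM('a) - 1"
    using st dim(1) by (simp add: stackable_def facet_of_def)
  have old: "{v} face_of convex hull insert p P" if v: "{v} face_of P" for v
  proof -
    have "aff_dim {v} \<noteq> aff_dim P" "aff_dim {v} \<noteq> aff_dim F"
      using Fdim dim unfolding aff_dim_sing by linarith+
    then have "{v} \<noteq> P" "{v} \<noteq> F"
      by metis+
    then show ?thesis
      using face_of_stacking_old[OF P st v] by simp
  qed
  have new: "{p} face_of convex hull insert p P"
  proof -
    obtain V where V: "finite V" "P = convex hull V"
      using P polytope_def by blast
    then have "p extreme_point_of (convex hull insert p V)"
      using extreme_point_of_convex_hull_insert stackable_notin[OF st] by blast
    then show ?thesis
      using V(2) hull_insert[of convex p V] face_of_singleton by metis
  qed
  show ?thesis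
    unfolding polytope_vertices_def
    using old new face_of_stacking_imp_face_of[OF P] by blast
qed

text \<open>
  In dimension at least \<open>3\<close> an edge is not a facet. In the plane this fails: stacking onto an edge
  of a polygon destroys it.
\<close>

lemma edge_of_stacking_old:
  fixes P :: "'a::euclidean_space set"
  assumes P: "polytope P" and dim: "aff_dim P = DIM('a)" "DIM('a) \<ge> 3"
    and st: "stackable P F p" and p: "p \<notin> E"
  shows "E edge_of convex hull insert p P \<longleftrightarrow> E edge_of P"
proof -
  have Fdim: "aff_dim F = int DIM('a) - 1"
    using st dim(1) by (simp add: stackable_def facet_of_def)
  have "E face_of convex hull insert p P" if "E face_of P" "aff_dim E = 1"
  proof -
    have "aff_dim E \<noteq> aff_dim P" "aff_dim E \<noteq> aff_dim F"
      using Fdim dim that(2) by linarith+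
    then show ?thesis
      using face_of_stacking_old[OF P st that(1)] by auto
  qed
  then show ?thesis
    unfolding edge_of_def using face_of_stacking_imp_face_of[OF P _ p] by blast
qed

lemma edge_of_stacking_new:
  fixes P :: "'a::euclidean_space set"
  assumes P: "polytope P" and dim: "aff_dim P = DIM('a)" "DIM('a) \<ge> 2"
    and st: "stackable P F p" and v: "{v} face_of P"
  shows "closed_segment p v edge_of convex hull insert p P \<longleftrightarrow> v \<in> F"
proof
  have vP: "v \<in> P"
    using face_of_imp_subset[OF v] by simp
  then have "p \<noteq> v"
    using stackable_notin[OF st] by blast
  then have seg: "aff_dim (closed_segment p v) = 1"
    by (simp add: segment_convex_hull aff_dim_convex_hull)
  show "v \<in> F" if "closed_segment p v edge_of convex hull insert p P"
  proof (rule ccontr)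
    assume "v \<notin> F"
    then have "closed_segment p v = convex hull insert p P"
      using face_of_stacking_hidden[OF P dim(1) st vP] that by (auto simp: edge_of_def)
    then show False
      using seg aff_dim_stacking[OF dim(1), of p] dim(2) by simp
  qed
  have Fdim: "aff_dim F = int DIM('a) - 1"
    using st dim(1) by (simp add: stackable_def facet_of_def)
  show "closed_segment p v edge_of convex hull insert p P" if "v \<in> F"
  proof -
    have "aff_dim {v} \<noteq> aff_dim F"
      using Fdim dim unfolding aff_dim_sing by linarith
    then have "{v} \<noteq> F"
      by metis
    then have "convex hull insert p {v} face_of convex hull insert p P"
      using face_of_stacking_pyramid[OF P st v] that by auto
    then show ?thesis
      using seg by (simp add: edge_of_def segment_convex_hull)
  qed
qed

text \<open>
  The pyramid over a ridge in \<open>F\<close> is a facet on which one can stack next.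
\<close>

lemma facet_of_stacking_new:
  fixes P :: "'a::euclidean_space set"
  assumes P: "polytope P" and dim: "aff_dim P = DIM('a)"
    and st: "stackable P F p" and T: "T facet_of F"
  shows "convex hull insert p T facet_of convex hull insert p P"
proof -
  have F: "F facet_of P"
    using st by (simp add: stackable_def)
  have T_face: "T face_of P" "T \<subseteq> F" "T \<noteq> F" "T \<noteq> {}"
    using face_of_trans[OF facet_of_imp_face_of[OF T] facet_of_imp_face_of[OF F]]
      facet_of_imp_subset[OF T] T by (auto simp: facet_of_def)
  have "p \<notin> affine hull T"
    using stackable_notin_affine_hull[OF st] hull_mono[OF T_face(2), of affine] by blast
  then have "aff_dim (convex hull insert p T) = aff_dim T + 1"
    by (simp add: aff_dim_convex_hull aff_dim_insert)
  also have "\<dots> = aff_dim (convex hull insert p P) - 1"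
    using T F aff_dim_stacking[OF dim, of p] dim by (simp add: facet_of_def)
  finally show ?thesis
    using face_of_stacking_pyramid[OF P st T_face] by (simp add: facet_of_def)
qed

section \<open>Stacking along a path\<close>

text \<open>
  The invariant of the construction. The third clause names the facet for the next stacking, the
  one spanned by the last \<open>d\<close> points. The last clause says that the graph is the \<open>d\<close>-th power of
  the path \<open>p 0, \<dots>, p k\<close>.
\<close>

definition stacked_path :: "nat \<Rightarrow> (nat \<Rightarrow> 'a::euclidean_space) \<Rightarrow> bool"
  where "stacked_path k p \<longleftrightarrow>
    stacked_polytope DIM('a) (convex hull (p ` {..k})) \<and>
    aff_dim (convex hull (p ` {..k})) = DIM('a) \<and>
    convex hull (p ` {k - DIM('a)<..k}) facet_of convex hull (p ` {..k}) \<and>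
    inj_on p {..k} \<and>
    polytope_vertices (convex hull (p ` {..k})) = p ` {..k} \<and>
    (\<forall>i j. i < j \<longrightarrow> j \<le> k \<longrightarrow>
      (closed_segment (p i) (p j) edge_of convex hull (p ` {..k}) \<longleftrightarrow> j \<le> i + DIM('a)))"

text \<open>
  For the vertices of a simplex all pairs are adjacent, and the condition \<open>j \<le> i + d\<close> is no
  restriction on indices up to \<open>d\<close>.
\<close>

lemma stacked_path_simplex:
  "\<exists>p :: nat \<Rightarrow> 'a::euclidean_space. stacked_path DIM('a) p"
proof -
  let ?d = "DIM('a)"
  obtain C :: "'a set" where C: "\<not> affine_dependent C" "affine hull C = UNIV"
    using affine_basis_exists[of UNIV] by (metis affine_UNIV hull_same)
  have card: "card C = ?d + 1"
    using aff_dim_unique[of C "UNIV :: 'a set"] C by simp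
  have fin: "finite C"
    using C(1) aff_independent_finite by blast
  obtain p where p: "bij_betw p {0..<?d + 1} C"
    using ex_bij_betw_nat_finite[OF fin] card by auto
  have "{0..<?d + 1} = {..?d}"
    by auto
  then have inj: "inj_on p {..?d}" and C_eq: "p ` {..?d} = C"
    using p by (auto simp: bij_betw_def)
  have dim: "aff_dim (convex hull C) = ?d"
    using C(2) by (simp add: aff_dim_convex_hull aff_dim_eq_full)
  have "stacked_polytope ?d (convex hull C)"
    by (intro stacked_polytope.simplex simplex_convex_hull) (simp add: C card)
  moreover have "convex hull (p ` {0<..?d}) facet_of convex hull C"
  proof -
    have "p ` {0<..?d} = C - {p 0}"
    proof -
      have "{0<..?d} = {..?d} - {0}"
        by auto
      then show ?thesis
        using inj_on_image_set_diff[OF inj, of "{..?d}" "{0}"] C_eq by simp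
    qed
    moreover have "p 0 \<in> C"
      using C_eq by auto
    moreover have "p ` {0<..?d} \<noteq> {}"
      by simp
    ultimately show ?thesis
      unfolding facet_of_convex_hull_affine_independent[OF C(1)] by (metis convex_hull_eq_empty)
  qed
  moreover have "polytope_vertices (convex hull C) = C"
    unfolding polytope_vertices_def face_of_singleton
    using extreme_point_of_convex_hull_affine_independent[OF C(1)] by auto
  moreover have "closed_segment (p i) (p j) edge_of convex hull C" if "i < j" "j \<le> ?d" for i j
  proof -
    have "{p i, p j} \<subseteq> C" "p i \<noteq> p j"
      using that C_eq inj_onD[OF inj, of i j] by auto
    then show ?thesis
      unfolding edge_of_def segment_convex_hull face_of_convex_hull_affine_independent[OF C(1)]
      by (intro conjI exI[of _ "{p i, p j}"]) (simp_all add: aff_dim_convex_hull)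
  qed
  ultimately have "stacked_path ?d p"
    unfolding stacked_path_def C_eq using dim inj by simp
  then show ?thesis
    by blast
qed

text \<open>
  The facet spanned by the last \<open>d\<close> points is a simplex because its dimension is \<open>d - 1\<close>. Hence
  dropping its oldest vertex leaves a facet of it, and the pyramid over that one, with the new point
  as apex, is the facet needed for the next step.
\<close>

lemma stacked_path_extend:
  fixes p :: "nat \<Rightarrow> 'a::euclidean_space"
  assumes sp: "stacked_path k p" and d3: "DIM('a) \<ge> 3" and k: "DIM('a) \<le> k"
  shows "\<exists>q. stacked_path (Suc k) (p(Suc k := q))"
proof -
  let ?d = "DIM('a)"
  define P where "P = convex hull (p ` {..k})"
  define F where "F = convex hull (p ` {k - ?d<..k})"
  have stk: "stacked_polytope ?d P" and dim: "aff_dim P = ?d" and F: "F facet_of P"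
    and inj: "inj_on p {..k}" and vert: "polytope_vertices P = p ` {..k}"
    and edges: "\<And>i j. i < j \<Longrightarrow> j \<le> k \<Longrightarrow>
        closed_segment (p i) (p j) edge_of P \<longleftrightarrow> j \<le> i + ?d"
    using sp unfolding stacked_path_def P_def F_def by auto
  have P: "polytope P"
    unfolding P_def by (simp add: polytope_convex_hull)
  have d2: "?d \<ge> 2"
    using d3 by simp
  obtain q where q: "stackable P F q"
    using exists_stackable_point[OF P F] by blast
  define r where "r = p(Suc k := q)"
  have r_old: "r i = p i" if "i \<le> k" for i
    using that by (simp add: r_def)
  have r_new: "r (Suc k) = q"
    by (simp add: r_def)
  have img_all: "r ` {..Suc k} = insert q (p ` {..k})"
    by (auto simp: r_def atMost_Suc)
  have P': "convex hull (r ` {..Suc k}) = convex hull insert q P"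
    unfolding img_all P_def by (rule hull_insert)
  have vertP: "{p i} face_of P" if "i \<le> k" for i
    using vert that unfolding polytope_vertices_def by blast
  have pP: "p i \<in> P" if "i \<le> k" for i
    using that unfolding P_def by (auto intro: hull_inc)
  have "q \<notin> P"
    using stackable_notin[OF q] .
  have indep: "\<not> affine_dependent (p ` {k - ?d<..k})"
  proof -
    have "card (p ` {k - ?d<..k}) = ?d"
      using k by (subst card_image[OF inj_on_subset[OF inj]]) auto
    moreover have "aff_dim (p ` {k - ?d<..k}) = ?d - 1"
      using F dim unfolding facet_of_def F_def by (simp add: aff_dim_convex_hull)
    ultimately show ?thesis
      unfolding affine_independent_iff_card by simp
  qed
  have F_iff: "p i \<in> F \<longleftrightarrow> k - ?d < i" if i: "i \<le> k" for i
  proof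
    assume "p i \<in> F"
    then have "{p i} face_of F"
      using face_of_subset[OF vertP[OF i]] facet_of_imp_subset[OF F] by simp
    then have "p i \<in> p ` {k - ?d<..k}"
      unfolding F_def face_of_singleton by (rule extreme_point_of_convex_hull)
    then show "k - ?d < i"
      using inj_on_eq_iff[OF inj] i by auto
  next
    assume "k - ?d < i"
    then show "p i \<in> F"
      unfolding F_def using i by (auto intro: hull_inc)
  qed
  define T where "T = convex hull (p ` {Suc k - ?d<..k})"
  have "T facet_of F"
  proof -
    have "{k - ?d<..k} - {Suc k - ?d} = {Suc k - ?d<..k}"
      using k by auto
    moreover have "p ` ({k - ?d<..k} - {Suc k - ?d}) = p ` {k - ?d<..k} - p ` {Suc k - ?d}"
      using k d2 by (intro inj_on_image_set_diff[OF inj]) auto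
    ultimately have "p ` {Suc k - ?d<..k} = p ` {k - ?d<..k} - {p (Suc k - ?d)}"
      by simp
    moreover have "p (Suc k - ?d) \<in> p ` {k - ?d<..k}"
      using k d2 by (intro imageI) auto
    moreover have "p ` {Suc k - ?d<..k} \<noteq> {}"
      using k d2 by simp
    ultimately show ?thesis
      unfolding F_def T_def facet_of_convex_hull_affine_independent[OF indep]
      by (metis convex_hull_eq_empty)
  qed
  have "stacked_polytope ?d (convex hull insert q P)"
  proof (rule stacked_polytope.stack[OF stk F])
    show "q \<in> affine hull P"
      using dim aff_dim_eq_full[of P] by simp
  qed (use q in \<open>auto simp: stackable_def\<close>)
  moreover have "convex hull (r ` {Suc k - ?d<..Suc k}) facet_of convex hull insert q P"
  proof -
    have "{Suc k - ?d<..Suc k} = insert (Suc k) {Suc k - ?d<..k}"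
      using d2 by auto
    then have "r ` {Suc k - ?d<..Suc k} = insert q (p ` {Suc k - ?d<..k})"
      by (auto simp: r_def)
    then have "convex hull (r ` {Suc k - ?d<..Suc k}) = convex hull insert q T"
      unfolding T_def by (simp add: hull_insert[symmetric])
    then show ?thesis
      using facet_of_stacking_new[OF P dim q \<open>T facet_of F\<close>] by simp
  qed
  moreover have "inj_on r {..Suc k}"
  proof -
    have "inj_on r {..k}"
      using inj by (simp add: inj_on_def r_old)
    moreover have "q \<notin> r ` {..k}"
      using \<open>q \<notin> P\<close> pP r_old by auto
    ultimately show ?thesis
      by (simp add: atMost_Suc r_new)
  qed
  moreover have "polytope_vertices (convex hull insert q P) = r ` {..Suc k}"
    using polytope_vertices_stacking[OF P dim d2 q] vert img_all by simp
  moreover have "closed_segment (r i) (r j) edge_of convex hull insert q P \<longleftrightarrow> j \<le> i + ?d"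
    if ij: "i < j" "j \<le> Suc k" for i j
  proof (cases "j = Suc k")
    case True
    have "closed_segment (r i) (r j) = closed_segment q (p i)"
      using ij True by (simp only: r_new r_old less_Suc_eq_le closed_segment_commute)
    moreover have "closed_segment q (p i) edge_of convex hull insert q P \<longleftrightarrow> p i \<in> F"
      using edge_of_stacking_new[OF P dim d2 q vertP, of i] ij True by simp
    ultimately have "closed_segment (r i) (r j) edge_of convex hull insert q P \<longleftrightarrow> p i \<in> F"
      by (simp only:)
    also have "\<dots> \<longleftrightarrow> j \<le> i + ?d"
      using F_iff[of i] ij True k by auto
    finally show ?thesis .
  next
    case False
    then have j: "j \<le> k"
      using ij by simp
    have "closed_segment (p i) (p j) \<subseteq> P"
      using pP ij j polytope_imp_convex[OF P] by (intro closed_segment_subset) auto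
    then have "q \<notin> closed_segment (p i) (p j)"
      using \<open>q \<notin> P\<close> by blast
    then show ?thesis
      using edge_of_stacking_old[OF P dim d3 q] edges[OF ij(1) j] ij j r_old by simp
  qed
  ultimately have "stacked_path (Suc k) r"
    unfolding stacked_path_def P' using aff_dim_stacking[OF dim] by simp
  then show ?thesis
    unfolding r_def by blast
qed

lemma stacked_path_exists:
  assumes "DIM('a::euclidean_space) \<ge> 3" "DIM('a) \<le> k"
  shows "\<exists>p :: nat \<Rightarrow> 'a. stacked_path k p"
  using assms(2)
proof (induction k rule: dec_induct)
  case base
  show ?case
    by (rule stacked_path_simplex)
next
  case (step k)
  then show ?case
    using stacked_path_extend assms(1) by blast
qed

section \<open>Counting bichromatic edges\<close>

text \<open>
  The subtraction on the left is truncated, so the summands with \<open>t \<ge> d\<close> vanish; this is the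
  origin of the minimum in the formula.
\<close>

lemma sum_truncated_diff:
  "real (\<Sum>t<n. d - t) = real (min d n) * (2 * real d + 1 - real (min d n)) / 2"
proof (induction n)
  case (Suc n)
  show ?case
  proof (cases "n < d")
    case True
    then have "min d n = n" "min d (Suc n) = Suc n"
      by auto
    then show ?thesis
      using Suc True by (simp add: of_nat_diff field_simps)
  next
    case False
    then have "min d n = d" "min d (Suc n) = d" "d - n = 0"
      by auto
    then show ?thesis
      using Suc by simp
  qed
qed simp

text \<open>
  An edge between the colours is determined by a white point \<open>p (b + t)\<close> and one of its black
  neighbours \<open>p i\<close>, where \<open>b + t - d \<le> i < b\<close>. The hypothesis \<open>d \<le> b\<close> makes this range have exactly
  \<open>d - t\<close> elements, with \<open>d - t = 0\<close> for \<open>t > d\<close>.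
\<close>

lemma card_edges_between_stacked_path:
  fixes p :: "nat \<Rightarrow> 'a::euclidean_space"
  assumes sp: "stacked_path k p" and k: "Suc k = w + b" and b: "DIM('a) \<le> b"
  shows "card (edges_between (convex hull (p ` {..k})) (p ` {b..k}) (p ` {..<b}))
    = (\<Sum>t<w. DIM('a) - t)"
proof -
  let ?d = "DIM('a)"
  define I where "I = Sigma {..<w} (\<lambda>t. {b + t - ?d..<b})"
  define e where "e = (\<lambda>(t, i). closed_segment (p (b + t)) (p i))"
  have inj: "inj_on p {..k}"
    and edges: "\<And>i j. i < j \<Longrightarrow> j \<le> k \<Longrightarrow>
        closed_segment (p i) (p j) edge_of convex hull (p ` {..k}) \<longleftrightarrow> j \<le> i + ?d"
    using sp unfolding stacked_path_def by auto
  have p_eq: "p i = p j \<longleftrightarrow> i = j" if "i \<le> k" "j \<le> k" for i j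
    using inj_on_eq_iff[OF inj] that by simp
  have edge_iff: "closed_segment (p (b + t)) (p i) edge_of convex hull (p ` {..k})
      \<longleftrightarrow> b + t - ?d \<le> i" if "t < w" "i < b" for t i
    using edges[of i "b + t"] that k by (auto simp: closed_segment_commute)
  have white: "{b..k} = (\<lambda>t. b + t) ` {..<w}"
  proof -
    have "x \<in> (\<lambda>t. b + t) ` {..<w}" if "x \<in> {b..k}" for x
      using that k by (intro image_eqI[of _ _ "x - b"]) auto
    then show ?thesis
      using k by auto
  qed
  have "edges_between (convex hull (p ` {..k})) (p ` {b..k}) (p ` {..<b}) = e ` I"
  proof (intro equalityI subsetI)
    fix E assume "E \<in> edges_between (convex hull (p ` {..k})) (p ` {b..k}) (p ` {..<b})"
    then obtain t i where "t < w" "i < b" "E = closed_segment (p (b + t)) (p i)"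
      "E edge_of convex hull (p ` {..k})"
      unfolding edges_between_def white by blast
    then show "E \<in> e ` I"
      using edge_iff[of t i] by (intro image_eqI[of _ _ "(t, i)"]) (auto simp: e_def I_def)
  next
    fix E assume "E \<in> e ` I"
    then obtain t i where "t < w" "i < b" "b + t - ?d \<le> i" "E = closed_segment (p (b + t)) (p i)"
      unfolding e_def I_def by auto
    then show "E \<in> edges_between (convex hull (p ` {..k})) (p ` {b..k}) (p ` {..<b})"
      unfolding edges_between_def white using edge_iff[of t i] by blast
  qed
  moreover have "inj_on e I"
  proof (rule inj_onI, clarify)
    fix t i t' i'
    assume ti: "(t, i) \<in> I" "(t', i') \<in> I" and eq: "e (t, i) = e (t', i')"
    then have "{p (b + t), p i} = {p (b + t'), p i'}"
      by (simp add: e_def)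
    then show "t = t' \<and> i = i'"
      using ti k p_eq[of "b + t" "b + t'"] p_eq[of i i'] p_eq[of "b + t" i']
      by (auto simp: doubleton_eq_iff I_def)
  qed
  ultimately have "card (edges_between (convex hull (p ` {..k})) (p ` {b..k}) (p ` {..<b})) = card I"
    by (simp add: card_image)
  also have "\<dots> = (\<Sum>t<w. b - (b + t - ?d))"
    by (simp add: I_def)
  also have "\<dots> = (\<Sum>t<w. ?d - t)"
    using b by (intro sum.cong) auto
  finally show ?thesis .
qed

theorem proposition14:
  fixes d v\<^sub>1 v\<^sub>2 :: nat
  assumes "CARD('n::finite) = d" and "d \<ge> 3" and "v\<^sub>1 \<ge> 1" and "v\<^sub>2 \<ge> d"
  shows "\<exists>(S :: (real ^ 'n) set) V\<^sub>1 V\<^sub>2.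
    stacked_polytope d S \<and>
    V\<^sub>1 \<union> V\<^sub>2 = polytope_vertices S \<and> V\<^sub>1 \<inter> V\<^sub>2 = {} \<and>
    card V\<^sub>1 = v\<^sub>1 \<and> card V\<^sub>2 = v\<^sub>2 \<and>
    (let m = min d v\<^sub>1 in
      real (card (edges_between S V\<^sub>1 V\<^sub>2)) = real m * (2 * real d + 1 - real m) / 2)"
proof -
  define k where "k = v\<^sub>1 + v\<^sub>2 - 1"
  have k: "Suc k = v\<^sub>1 + v\<^sub>2"
    using assms by (simp add: k_def)
  have dim: "DIM(real ^ 'n) = d"
    using assms(1) by simp
  obtain p :: "nat \<Rightarrow> real ^ 'n" where p: "stacked_path k p"
    using stacked_path_exists[where 'a = "real ^ 'n" and k = k] dim assms k by auto
  then have inj: "inj_on p {..k}" and stk: "stacked_polytope d (convex hull (p ` {..k}))"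
    and vert: "polytope_vertices (convex hull (p ` {..k})) = p ` {..k}"
    unfolding stacked_path_def dim by auto
  have split: "{v\<^sub>2..k} \<union> {..<v\<^sub>2} = {..k}" "{v\<^sub>2..k} \<inter> {..<v\<^sub>2} = {}"
    using k assms by auto
  have "p ` {v\<^sub>2..k} \<union> p ` {..<v\<^sub>2} = polytope_vertices (convex hull (p ` {..k}))"
    unfolding vert image_Un[symmetric] split(1) ..
  moreover have "p ` {v\<^sub>2..k} \<inter> p ` {..<v\<^sub>2} = {}"
    using inj_on_image_Int[OF inj, of "{v\<^sub>2..k}" "{..<v\<^sub>2}"] split by auto
  moreover have "card (p ` {v\<^sub>2..k}) = v\<^sub>1" "card (p ` {..<v\<^sub>2}) = v\<^sub>2"
    using split(1) k by (subst card_image[OF inj_on_subset[OF inj]]; auto)+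
  moreover have "card (edges_between (convex hull (p ` {..k})) (p ` {v\<^sub>2..k}) (p ` {..<v\<^sub>2}))
      = (\<Sum>t<v\<^sub>1. d - t)"
    using card_edges_between_stacked_path[OF p k] dim assms(4) by simp
  ultimately show ?thesis
    using stk sum_truncated_diff[of d v\<^sub>1] unfolding Let_def by metis
qed

end
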